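(* Let $\xi>-1$ be real and let $f,g\in\mathcal{A}_\xi^2$ have power series expansions $f(z)=\sum_{k=0}^\infty a_kz^k$ and $g(z)=\sum_{k=0}^\infty b_kz^k$ with $a_k,b_k\in\mathbb{C}$. Let $L=f\frac{d}{dz}+g$ be the operator in $\mathcal{A}_\xi^2$ with domain $\mathcal{D}(L)=P(\mathbb{D})$, given by $Lp=fp'+gp$. Then $L$ is symmetric if and only if $$f(z)=a_0+a_1z+\overline{a_0}z^2\quad\text{and}\quad g(z)=b_0+(\xi+2)\overline{a_0}z,\qquad\text{where } a_1,b_0\in\mathbb{R}.$$
   Context: $\mathbb{D}=\{z\in\mathbb{C}:|z|<1\}$, $H(\mathbb{D})$ is the space of holomorphic functions on $\mathbb{D}$, and $dz$ denotes the Euclidean (area) measure on $\mathbb{C}$. For $\xi>-1$ let $d\nu_\xi(z)=\frac{\xi+1}{\pi}(1-|z|^2)^\xi\,dz$, a probability measure on $\mathbb{D}$. The weighted Bergman space $\mathcal{A}_\xi^2$ is the Hilbert space of $f\in H(\mathbb{D})$ with $\|f\|_\xi^2=\int_{\mathbb{D}}|f|^2\,d\nu_\xi<\infty$, with inner product $\langle f,g\rangle_\xi=\int_{\mathbb{D}}f\overline{g}\,d\nu_\xi$. $P(\mathbb{D})\subseteq\mathcal{A}_\xi^2$ is the space of polynomials in $z$ with complex coefficients, viewed as functions on $\mathbb{D}$. (For $f,g\in\mathcal{A}_\xi^2$ and a polynomial $p$, $fp'+gp\in\mathcal{A}_\xi^2$.) The operator $L$ is symmetric if $\langle Lp,q\rangle_\xi=\langle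 p,Lq\rangle_\xi$ for all $p,q\in\mathcal{D}(L)$. *)

theory Defs
  imports "HOL-Analysis.Analysis"
begin

definition unit_disc :: "complex set" where
  "unit_disc = ball 0 1"

definition bergman_measure :: "real \<Rightarrow> complex measure" where
  "bergman_measure \<xi> =
     density (restrict_space lborel unit_disc)
       (\<lambda>z. ennreal ((\<xi> + 1) / pi * (1 - (cmod z)\<^sup>2) powr \<xi>))"

text \<open>
  Functions on the disc are represented by total functions on the complex plane whose values
  off the disc are irrelevant; a polynomial function on the disc is represented by its extension
  to the plane.
\<close>

definition bergman_space :: "real \<Rightarrow> (complex \<Rightarrow> complex) set" where
  "bergman_space \<xi> =
     {f. f holomorphic_on unit_disc \<and> integrable (bergman_measure \<xi>) (\<lambda>z. (cmod (f z))\<^sup>2)}"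

definition bergman_inner :: "real \<Rightarrow> (complex \<Rightarrow> complex) \<Rightarrow> (complex \<Rightarrow> complex) \<Rightarrow> complex" where
  "bergman_inner \<xi> f g = (LINT z|bergman_measure \<xi>. f z * cnj (g z))"

definition polynomial_functions :: "(complex \<Rightarrow> complex) set" where
  "polynomial_functions = range poly"

definition first_order_operator ::
    "(complex \<Rightarrow> complex) \<Rightarrow> (complex \<Rightarrow> complex) \<Rightarrow> (complex \<Rightarrow> complex) \<Rightarrow> complex \<Rightarrow> complex" where
  "first_order_operator f g p = (\<lambda>z. f z * deriv p z + g z * p z)"

text \<open>
  An unbounded operator is given by its domain \<open>D\<close> and a map \<open>T\<close>, of which only the values
  on \<open>D\<close> matter.
\<close>

definition symmetric_operator ::
    "real \<Rightarrow> (complex \<Rightarrow> complex) set \<Rightarrow> ((complex \<Rightarrow> complex) \<Rightarrow> complex \<Rightarrow> complex) \<Rightarrow> bool" where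
  "symmetric_operator \<xi> D T \<longleftrightarrow>
     (\<forall>p\<in>D. \<forall>q\<in>D. bergman_inner \<xi> (T p) q = bergman_inner \<xi> p (T q))"

end

theory Submission
  imports Defs "HOL-Real_Asymp.Real_Asymp" "HOL-Computational_Algebra.Polynomial"
begin

text \<open>
  The monomials are orthogonal in the Bergman space, because the measure is invariant under
  rotations, and the squared norm \<open>w\<^sub>n\<close> of \<open>z\<^sup>n\<close> is \<open>\<xi> + 1\<close> times an Euler Beta value. Consequently the
  inner product of a function \<open>\<Sum> c\<^sub>k z\<^sup>k\<close> with \<open>z\<^sup>n\<close> is \<open>c\<^sub>n w\<^sub>n\<close>
  (\<open>integral_bergman_coefficient\<close>), and symmetry of \<open>L\<close> on polynomials becomes a condition on a
  matrix: with \<open>\<lambda>\<^sub>m\<^sub>j\<close> the coefficient of \<open>z\<^sup>j\<close> in \<open>L z\<^sup>m\<close>, the numbers \<open>\<lambda>\<^sub>m\<^sub>n w\<^sub>n\<close> must form a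
  Hermitian matrix (\<open>symmetric_first_order_operator_iff_matrix\<close>).

  Since \<open>\<lambda>\<^sub>m\<^sub>j = m a\<^bsub>j-m+1\<^esub> + b\<^bsub>j-m\<^esub>\<close>, with coefficients of negative index read as zero, the matrix
  has no entries further than one step to the side where the degree drops. The Hermitian condition
  therefore kills every \<open>b\<^sub>k\<close> with \<open>k \<ge> 2\<close> and every \<open>a\<^sub>k\<close> with \<open>k \<ge> 3\<close>, makes \<open>a\<^sub>1\<close> and \<open>b\<^sub>0\<close>
  real, and, through the ratio \<open>w\<^sub>n\<^sub>+\<^sub>1 / w\<^sub>n = (n + 1) / (n + \<xi> + 2)\<close>, ties \<open>a\<^sub>2\<close> and \<open>b\<^sub>1\<close> to \<open>a\<^sub>0\<close>
  (\<open>operator_matrix_hermitian_iff\<close>). Conversely these relations make the matrix Hermitian. Uniqueness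
  of the Taylor coefficients translates them into the formulas for \<open>f\<close> and \<open>g\<close>.
\<close>

section \<open>Rotation invariance of area in the plane\<close>

text \<open>
  Invariance of Lebesgue measure under orthogonal maps is a theorem about \<open>real ^ 'n\<close>; this
  identification of \<open>real ^ 2\<close> with the complex plane carries it over.
\<close>

lemma lborel_complex_eq_distr:
  "lborel = distr lborel borel (\<lambda>v :: real ^ 2. Complex (v $ 1) (v $ 2))"
proof (rule lborel_eqI)
  fix l u :: complex assume le: "\<And>b. b \<in> Basis \<Longrightarrow> l \<bullet> b \<le> u \<bullet> b"
  let ?l = "(\<chi> i. if i = 1 then Re l else Im l) :: real ^ 2"
    and ?u = "(\<chi> i. if i = 1 then Re u else Im u) :: real ^ 2"
  have m: "(\<lambda>v :: real ^ 2. Complex (v $ 1) (v $ 2)) \<in> borel_measurable borel"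
    by (simp add: borel_measurable_complex_iff)
  have B: "(Basis :: (real ^ 2) set) = range (\<lambda>i. axis i 1)"
    by (auto simp: Basis_vec_def)
  have inj: "inj (\<lambda>i :: 2. axis i (1 :: real))"
    by (auto simp: inj_def axis_eq_axis)
  have re_im: "Re l \<le> Re u" "Im l \<le> Im u"
    using le[of 1] le[of \<i>] by (auto simp: Basis_complex_def)
  have "(\<lambda>v :: real ^ 2. Complex (v $ 1) (v $ 2)) -` box l u = box ?l ?u"
    by (auto simp: mem_box_cart box_Complex_eq forall_2 mem_box Basis_complex_def)
  hence "emeasure (distr lborel borel (\<lambda>v :: real ^ 2. Complex (v $ 1) (v $ 2))) (box l u)
      = emeasure lborel (box ?l ?u)"
    using m by (subst emeasure_distr) auto
  also have "\<dots> = (\<Prod>b\<in>Basis. (?u - ?l) \<bullet> b)"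
    using re_im by (intro emeasure_lborel_box) (auto simp: B inner_axis forall_2 split: if_splits)
  also have "(\<Prod>b\<in>Basis. (?u - ?l) \<bullet> b) = (\<Prod>b\<in>Basis. (u - l) \<bullet> b)"
    by (simp add: B prod.reindex[OF inj] inner_axis axis_eq_axis UNIV_2 Basis_complex_def)
  finally show "emeasure (distr lborel borel (\<lambda>v :: real ^ 2. Complex (v $ 1) (v $ 2))) (box l u)
      = (\<Prod>b\<in>Basis. (u - l) \<bullet> b)" .
qed simp

lemma lborel_distr_unimodular_mult:
  fixes c :: complex
  assumes c: "cmod c = 1"
  shows "distr lborel borel ((*) c) = lborel"
proof (rule lborel_eqI[symmetric])
  fix l u :: complex assume le: "\<And>b. b \<in> Basis \<Longrightarrow> l \<bullet> b \<le> u \<bullet> b"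
  define \<phi> where "\<phi> = (\<lambda>v :: real ^ 2. Complex (v $ 1) (v $ 2))"
  define R where "R = (\<lambda>v :: real ^ 2. 
     (\<chi> i. if i = 1 then Re (cnj c * \<phi> v) else Im (cnj c * \<phi> v)) :: real ^ 2)"
  have \<phi>_meas [measurable]: "\<phi> \<in> borel_measurable borel"
    by (simp add: borel_measurable_complex_iff \<phi>_def)
  have \<phi>: "lborel = distr lborel borel \<phi>"
    unfolding \<phi>_def by (rule lborel_complex_eq_distr)
  have \<phi>R: "\<phi> (R v) = cnj c * \<phi> v" for v
    by (simp add: \<phi>_def R_def complex_eq_iff)
  have norm_\<phi>: "cmod (\<phi> v) = norm v" for v
    by (simp add: \<phi>_def norm_vec_def L2_set_def cmod_def UNIV_2)
  have "linear R"
    by (rule linearI) (simp_all add: R_def \<phi>_def vec_eq_iff forall_2 algebra_simps)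
  moreover have "norm (R v) = norm v" for v
    using c by (simp add: norm_\<phi>[symmetric] \<phi>R norm_mult)
  ultimately have R: "orthogonal_transformation R"
    by (simp add: orthogonal_transformation)
  have c1: "c * cnj c = 1"
    using c by (simp add: complex_norm_square[symmetric])
  let ?S = "\<phi> -` box l u"
  have S_eq: "?S = box (\<chi> i. if i = 1 then Re l else Im l) (\<chi> i. if i = 1 then Re u else Im u)"
    by (auto simp: \<phi>_def mem_box_cart box_Complex_eq forall_2 mem_box Basis_complex_def)
  have S: "?S \<in> lmeasurable" unfolding S_eq by simp
  \<comment> \<open>Pulling the box back along the rotation amounts to rotating its planar copy by the inverse.\<close>
  have image: "\<phi> -` ((*) c -` box l u) = R ` ?S"
  proof (intro set_eqI iffI)
    fix v assume v: "v \<in> \<phi> -` ((*) c -` box l u)"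
    obtain w where w: "v = R w"
      using orthogonal_transformation_surj[OF R] by (metis surjD)
    have "c * \<phi> v = \<phi> w" using c1 by (simp add: w \<phi>R mult.assoc[symmetric])
    thus "v \<in> R ` ?S" using v w by auto
  next
    fix v assume "v \<in> R ` ?S"
    thus "v \<in> \<phi> -` ((*) c -` box l u)"
      using c1 by (auto simp: \<phi>R mult.assoc[symmetric])
  qed
  have RS: "R ` ?S \<in> sets borel"
    unfolding image[symmetric] using measurable_sets_borel[OF \<phi>_meas]
    measurable_sets_borel[of "(*) c"  borel "box l u"] by auto
  have "emeasure (distr lborel borel ((*) c)) (box l u) = emeasure lborel ((*) c -` box l u)"
    by (subst emeasure_distr) auto
  also have "\<dots> = emeasure lborel (\<phi> -` ((*) c -` box l u))"
    using measurable_sets_borel[of "(*) c" borel "box l u"] by (subst \<phi>, subst emeasure_distr) auto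
  also have "\<dots> = emeasure lebesgue (R ` ?S)"
    using RS by (simp add: image)
  also have "\<dots> = emeasure lebesgue ?S"
    by (simp only: emeasure_eq_measure2[OF S] measure_orthogonal_image[OF R S]
      emeasure_eq_measure2[OF measurable_orthogonal_image[OF R S]])
  also have "\<dots> = emeasure lborel ?S" by (simp add: S_eq)
  also have "\<dots> = emeasure lborel (box l u)"
    by (subst \<phi>, subst emeasure_distr) auto
  finally show "emeasure (distr lborel borel ((*) c)) (box l u) = (\<Prod>b\<in>Basis. (u - l) \<bullet> b)"
    using le by (simp add: emeasure_lborel_box)
qed simp

section \<open>The moments of the Bergman measure\<close>

lemma emeasure_disc_complex:
  "0 \<le> r \<Longrightarrow> emeasure lborel (ball (0::complex) r) = ennreal (pi * r\<^sup>2)"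
  "0 \<le> r \<Longrightarrow> emeasure lborel (cball (0::complex) r) = ennreal (pi * r\<^sup>2)"
  by (simp_all add: emeasure_ball emeasure_cball unit_ball_vol_2)

text \<open>
  This replaces polar coordinates for radial integrands: the annulus \<open>x < \<bar>z\<bar>\<^sup>2 < 1\<close> has area
  \<open>\<pi> (1 - x)\<close>, so under area measure on the disc the variable \<open>\<bar>z\<bar>\<^sup>2\<close> is uniformly distributed
  on the unit interval, with total mass \<open>\<pi>\<close>.
\<close>

lemma distr_disc_norm_square:
  "distr (restrict_space lborel unit_disc) borel (\<lambda>z. (cmod z)\<^sup>2)
     = density lborel (\<lambda>t. ennreal pi * indicator {0..1} t)" (is "?M = ?N")
proof (rule measure_eqI_lessThan)
  have disc [measurable]: "unit_disc \<in> sets borel" by (simp add: unit_disc_def)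
  have m: "(\<lambda>z. (cmod z)\<^sup>2) \<in> borel_measurable (restrict_space lborel unit_disc)"
    by (intro measurable_restrict_space1) auto
  show eq: "emeasure ?M {x<..} = emeasure ?N {x<..}" for x
  proof -
    have "emeasure ?M {x<..} = emeasure lborel {z \<in> unit_disc. x < (cmod z)\<^sup>2}"
      using m disc
      by (subst emeasure_distr)
        (auto simp: emeasure_restrict_space space_restrict_space intro!: arg_cong[where f = "emeasure lborel"])
    also have "\<dots> = ennreal pi * emeasure lborel ({0..1} \<inter> {x<..})"
    proof (cases "x < 0")
      case True
      hence "x < (cmod z)\<^sup>2" for z
        by (rule less_le_trans) simp
      hence "{z \<in> unit_disc. x < (cmod z)\<^sup>2} = ball 0 1" "{0..1} \<inter> {x<..} = {0..1}"
        using True by (auto simp: unit_disc_def)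
      thus ?thesis by (simp add: emeasure_disc_complex)
    next
      case False
      show ?thesis
      proof (cases "x < 1")
        case True
        have eq: "{z \<in> unit_disc. x < (cmod z)\<^sup>2} = ball 0 1 - cball 0 (sqrt x)"
        proof -
          have "x < (cmod z)\<^sup>2 \<longleftrightarrow> sqrt x < cmod z" for z
            by (metis real_sqrt_less_iff real_sqrt_abs abs_norm_cancel)
          thus ?thesis by (simp add: unit_disc_def set_eq_iff not_le conj_commute)
        qed
        have "emeasure lborel (ball 0 1 - cball (0::complex) (sqrt x))
            = ennreal (pi * 1\<^sup>2) - ennreal (pi * (sqrt x)\<^sup>2)"
          using True False
          by (subst emeasure_Diff) (auto simp: emeasure_disc_complex subset_iff real_sqrt_lt_1_iff 
             intro: le_less_trans)
        also have "\<dots> = ennreal pi * ennreal (1 - x)"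
          using True False by (simp add: ennreal_minus ennreal_mult' [symmetric] algebra_simps)
        also have "ennreal (1 - x) = emeasure lborel {x<..1}"
          using True by simp
        also have "{x<..1} = {0..1} \<inter> {x<..}" using False by auto
        finally show ?thesis by (simp only: eq)
      next
        case ge: False
        have "\<not> x < (cmod z)\<^sup>2" if "z \<in> unit_disc" for z
          using that ge abs_square_less_1[of "cmod z"] by (simp add: unit_disc_def)
        hence "{z \<in> unit_disc. x < (cmod z)\<^sup>2} = {}" "{0..1} \<inter> {x<..} = {}"
          using ge by auto
        thus ?thesis by (simp only: emeasure_empty mult_zero_right)
      qed
    qed
    also have "\<dots> = emeasure ?N {x<..}"
      by (subst emeasure_density) (auto simp: nn_integral_cmult indicator_inter_arith[symmetric] mult.assoc)
    finally show ?thesis .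
  qed
  show "emeasure ?M {x<..} < \<infinity>" for x
  proof -
    have "emeasure ?M {x<..} \<le> emeasure ?N UNIV"
      unfolding eq by (intro emeasure_mono) auto
    also have "\<dots> = ennreal pi"
      by (subst emeasure_density) (auto simp: nn_integral_cmult)
    finally show ?thesis by (simp add: le_less_trans)
  qed
qed simp_all

lemma sets_bergman_measure [simp]: "sets (bergman_measure \<xi>) = sets (restrict_space borel unit_disc)"
  by (simp add: bergman_measure_def sets_restrict_space)

lemma space_bergman_measure [simp]: "space (bergman_measure \<xi>) = unit_disc"
  by (simp add: bergman_measure_def space_restrict_space)

lemma borel_measurable_bergman_measure [measurable (raw)]:
  "h \<in> borel_measurable borel \<Longrightarrow> h \<in> borel_measurable (bergman_measure \<xi>)"
  unfolding measurable_cong_sets[OF sets_bergman_measure refl]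
  by (rule measurable_restrict_space1)

text \<open>
  The value of \<open>\<integral> \<bar>z\<bar>\<^bsup>2n\<^esup>\<close> against the Bergman measure, that is, the squared norm of \<open>z\<^sup>n\<close>.
  The substitution \<open>t = \<bar>z\<bar>\<^sup>2\<close> turns the integral into an Euler Beta integral.
\<close>

definition bergman_moment :: "real \<Rightarrow> nat \<Rightarrow> real" where
  "bergman_moment \<xi> n = (\<xi> + 1) * Beta (real n + 1) (\<xi> + 1)"

lemma bergman_moment_pos: "\<xi> > -1 \<Longrightarrow> bergman_moment \<xi> n > 0"
  by (simp add: bergman_moment_def Beta_def)

text \<open>
  All that the classification of symmetric operators needs to know about the moments, apart from
  their positivity, is the ratio of consecutive ones; the constant \<open>\<xi> + 2\<close> in the answer
  comes from here.
\<close>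

lemma bergman_moment_Suc:
  "(real n + \<xi> + 2) * bergman_moment \<xi> (Suc n) = (real n + 1) * bergman_moment \<xi> n"
proof -
  have "real n + 1 \<notin> \<int>\<^sub>\<le>\<^sub>0"
    using nonpos_Ints_nonpos[of "real n + 1"] by linarith
  from Beta_plus1_left[OF this, of "\<xi> + 1"] show ?thesis
    by (simp add: bergman_moment_def algebra_simps)
qed

lemma nn_integral_norm_power_bergman:
  assumes "\<xi> > -1"
  shows "(\<integral>\<^sup>+ z. ennreal (cmod z ^ (2 * n)) \<partial>bergman_measure \<xi>) = ennreal (bergman_moment \<xi> n)"
proof -
  let ?D = "restrict_space lborel unit_disc"
  let ?F = "\<lambda>t. ennreal ((\<xi> + 1) / pi * (1 - t) powr \<xi>) * ennreal (t ^ n)"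
  let ?G = "\<lambda>t. (\<xi> + 1) * (t powr ((real n + 1) - 1) * (1 - t) powr ((\<xi> + 1) - 1))"
  have w: "(\<lambda>z. ennreal ((\<xi> + 1) / pi * (1 - (cmod z)\<^sup>2) powr \<xi>)) \<in> borel_measurable ?D"
    by (intro measurable_restrict_space1) measurable
  have "(\<integral>\<^sup>+ z. ennreal (cmod z ^ (2 * n)) \<partial>bergman_measure \<xi>) = (\<integral>\<^sup>+ z. ?F ((cmod z)\<^sup>2) \<partial>?D)"
    unfolding bergman_measure_def
    by (subst nn_integral_density[OF w])
      (auto simp: power_mult intro!: measurable_restrict_space1)
  also have "\<dots> = (\<integral>\<^sup>+ t. ?F t \<partial>distr ?D borel (\<lambda>z. (cmod z)\<^sup>2))"
    by (subst nn_integral_distr) (auto intro!: measurable_restrict_space1)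
  also have "\<dots> = (\<integral>\<^sup>+ t. ennreal pi * indicator {0..1} t * ?F t \<partial>lborel)"
    unfolding distr_disc_norm_square by (subst nn_integral_density) auto
  also have "\<dots> = (\<integral>\<^sup>+ t. ennreal (indicator {0..1} t * ?G t) \<partial>lborel)"
  proof (rule nn_integral_cong_AE)
    \<comment> \<open>At \<open>t = 0\<close> the two powers may differ, since \<open>0 ^ 0 = 1\<close> but \<open>0 powr 0 = 0\<close>.\<close>
    have "AE t in lborel. t \<noteq> (0 :: real)" by (rule AE_lborel_singleton)
    thus "AE t in lborel. ennreal pi * indicator {0..1} t * ?F t = ennreal (indicator {0..1} t * ?G t)"
    proof eventually_elim
      case (elim t)
      show ?case
      proof (cases "t \<in> {0..1}")
        case True
        have "ennreal pi * ?F t = ennreal (pi * ((\<xi> + 1) / pi * (1 - t) powr \<xi> * t ^ n))"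
          using True assms by (subst ennreal_mult, simp, simp, subst ennreal_mult) auto
        also have "pi * ((\<xi> + 1) / pi * (1 - t) powr \<xi> * t ^ n) = ?G t"
          using True elim by (simp add: powr_realpow)
        finally show ?thesis using True by simp
      qed simp
    qed
  qed
  also have "\<dots> = ennreal ((\<xi> + 1) * Beta (real n + 1) (\<xi> + 1))"
    using assms
    by (intro nn_integral_has_integral_lebesgue has_integral_mult_right has_integral_Beta_real) auto
  finally show ?thesis by (simp add: bergman_moment_def)
qed

lemma finite_measure_bergman: "\<xi> > -1 \<Longrightarrow> finite_measure (bergman_measure \<xi>)"
  using nn_integral_norm_power_bergman[of \<xi> 0] by (intro finite_measureI) simp

lemma has_bochner_integral_norm_power_bergman:
  assumes "\<xi> > -1"
  shows "has_bochner_integral (bergman_measure \<xi>) (\<lambda>z. cmod z ^ (2 * n)) (bergman_moment \<xi> n)"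
  using bergman_moment_pos[OF assms, of n]
  by (intro has_bochner_integral_nn_integral nn_integral_norm_power_bergman assms) auto

lemma integral_bergman_rotate:
  fixes h :: "complex \<Rightarrow> complex"
  assumes "\<xi> > -1" "cmod c = 1" and h [measurable]: "h \<in> borel_measurable borel"
  shows "(LINT z|bergman_measure \<xi>. h (c * z)) = (LINT z|bergman_measure \<xi>. h z)"
proof -
  let ?w = "\<lambda>z. (\<xi> + 1) / pi * (1 - (cmod z)\<^sup>2) powr \<xi>"
  have disc [measurable]: "unit_disc \<in> sets borel" by (simp add: unit_disc_def)
  have *: "(LINT z|bergman_measure \<xi>. k z) = (LINT z|lborel. indicator unit_disc z *\<^sub>R (?w z *\<^sub>R k z))"
    if [measurable]: "k \<in> borel_measurable borel" for k :: "complex \<Rightarrow> complex"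
    unfolding bergman_measure_def using assms(1)
    by (subst integral_density)
      (auto simp: integral_restrict_space intro!: measurable_restrict_space1)
  have "(LINT z|bergman_measure \<xi>. h (c * z))
      = (LINT z|lborel. indicator unit_disc (c * z) *\<^sub>R (?w (c * z) *\<^sub>R h (c * z)))"
    using assms(2) by (subst *) (auto simp: norm_mult unit_disc_def indicator_def)
  also have "\<dots> = (LINT z|distr lborel borel ((*) c). indicator unit_disc z *\<^sub>R (?w z *\<^sub>R h z))"
    by (subst integral_distr) auto
  also have "\<dots> = (LINT z|bergman_measure \<xi>. h z)"
    by (simp only: lborel_distr_unimodular_mult[OF assms(2)] *[OF h])
  finally show ?thesis .
qed

section \<open>Taylor coefficients as inner products\<close>

lemma borel_measurable_cnj [measurable]: "cnj \<in> borel_measurable borel"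
  by (intro borel_measurable_continuous_onI continuous_intros)

lemma borel_measurable_truncation:
  fixes h :: "complex \<Rightarrow> complex"
  assumes "h \<in> borel_measurable M" "(\<lambda>z. z) \<in> borel_measurable M"
  shows "(\<lambda>z. indicator (ball 0 r) z *\<^sub>R h z) \<in> borel_measurable M"
proof -
  have "ball (0 :: complex) r \<in> sets borel" by simp
  from measurable_compose[OF assms(2) borel_measurable_indicator[OF this]]
  show ?thesis using assms(1) by (rule borel_measurable_scaleR)
qed

lemma integrable_bergman_bounded_mult:
  fixes h k :: "complex \<Rightarrow> complex"
  assumes "integrable (bergman_measure \<xi>) h" "k \<in> borel_measurable borel"
    and "\<And>z. z \<in> unit_disc \<Longrightarrow> cmod (k z) \<le> C"
  shows "integrable (bergman_measure \<xi>) (\<lambda>z. h z * k z)"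
proof (rule Bochner_Integration.integrable_bound)
  show "integrable (bergman_measure \<xi>) (\<lambda>z. C * cmod (h z))"
    using assms(1) by simp
  show "(\<lambda>z. h z * k z) \<in> borel_measurable (bergman_measure \<xi>)"
    using assms(1,2)
    by (intro borel_measurable_times borel_measurable_bergman_measure[of k])
      (auto intro: borel_measurable_integrable)
  show "AE z in bergman_measure \<xi>. norm (h z * k z) \<le> norm (C * cmod (h z))"
  proof (rule AE_I2)
    fix z assume "z \<in> space (bergman_measure \<xi>)"
    hence "cmod (k z) \<le> \<bar>C\<bar>" using assms(3)[of z] by simp
    thus "norm (h z * k z) \<le> norm (C * cmod (h z))"
      using mult_left_mono[of "cmod (k z)" "\<bar>C\<bar>" "cmod (h z)"]
      by (simp add: norm_mult abs_mult mult.commute[of "\<bar>C\<bar>"])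
  qed
qed

lemma integral_bergman_monomials_orthogonal:
  assumes "\<xi> > -1" "m \<noteq> n"
  shows "(LINT z|bergman_measure \<xi>. indicator (ball 0 r) z *\<^sub>R (z ^ m * cnj z ^ n)) = (0 :: complex)"
proof -
  let ?h = "\<lambda>z :: complex. indicator (ball 0 r) z *\<^sub>R (z ^ m * cnj z ^ n)"
  define t where "t = pi / (real m - real n)"
  \<comment> \<open>The angle is chosen so that rotating by it changes the sign of the integrand.\<close>
  have "cis t ^ m * cnj (cis t) ^ n = cis (real m * t - real n * t)"
    by (simp add: cis_cnj Complex.DeMoivre cis_mult)
  also have "real m * t - real n * t = (real m - real n) * t" by (rule left_diff_distrib[symmetric])
  also have "\<dots> = pi" using assms(2) by (simp add: t_def)
  finally have c: "cis t ^ m * cnj (cis t) ^ n = -1" by simp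
  have rot: "?h (cis t * z) = - ?h z" for z
  proof -
    have "(cis t * z) ^ m * cnj (cis t * z) ^ n = (cis t ^ m * cnj (cis t) ^ n) * (z ^ m * cnj z ^ n)"
      by (simp add: power_mult_distrib mult_ac)
    thus ?thesis by (simp add: c indicator_def norm_mult)
  qed
  have "(LINT z|bergman_measure \<xi>. ?h (cis t * z)) = (LINT z|bergman_measure \<xi>. ?h z)"
    by (intro integral_bergman_rotate borel_measurable_truncation assms(1)) auto
  thus ?thesis unfolding rot by simp
qed

text \<open>
  On a disc of radius \<open>r < 1\<close> the power series converges absolutely and uniformly, so it may be
  integrated term by term, and orthogonality leaves only the term of index \<open>n\<close>.
\<close>

lemma integral_bergman_truncated_coefficient:
  fixes h :: "complex \<Rightarrow> complex"
  assumes \<xi>: "\<xi> > -1" and r: "0 < r" "r < 1"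
    and h: "\<And>z. z \<in> unit_disc \<Longrightarrow> (\<lambda>k. c k * z ^ k) sums h z"
  shows "(LINT z|bergman_measure \<xi>. indicator (ball 0 r) z *\<^sub>R (h z * cnj z ^ n))
    = c n * (LINT z|bergman_measure \<xi>. indicator (ball 0 r) z *\<^sub>R (z ^ n * cnj z ^ n))"
proof -
  let ?M = "bergman_measure \<xi>"
  interpret finite_measure ?M by (rule finite_measure_bergman[OF \<xi>])
  let ?f = "\<lambda>k z. indicator (ball 0 r) z *\<^sub>R (c k * z ^ k * cnj z ^ n)"
  have bound: "norm (?f k z) \<le> norm (c k * of_real r ^ k)" if "z \<in> unit_disc" for k z
  proof -
    have "cmod z ^ k * cmod z ^ n \<le> r ^ k * 1" if "cmod z < r"
      using that r by (intro mult_mono power_mono power_le_one) auto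
    hence "cmod (c k) * (cmod z ^ k * cmod z ^ n) \<le> cmod (c k) * r ^ k" if "cmod z < r"
      using that by (intro mult_left_mono) auto
    thus ?thesis
      using r by (auto simp: indicator_def norm_mult norm_power mult_ac)
  qed
  \<comment> \<open>Convergence at a point strictly between radius \<open>r\<close> and the boundary gives the absolutely
    summable majorant.\<close>
  have "cmod (of_real ((1 + r) / 2)) = (1 + r) / 2"
    using r by (subst norm_of_real) auto
  hence "of_real ((1 + r) / 2) \<in> unit_disc" "cmod (of_real r) < cmod (of_real ((1 + r) / 2))"
    using r by (simp_all add: unit_disc_def)
  hence summable: "summable (\<lambda>k. norm (c k * of_real r ^ k))"
    using h r by (intro powser_insidea[of c "of_real ((1 + r) / 2)"] sums_summable) auto
  have int: "integrable ?M (?f k)" for k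
    using bound by (intro integrable_const_bound[where B = "norm (c k * of_real r ^ k)"]
      AE_I2 borel_measurable_bergman_measure borel_measurable_truncation) auto
  have "(\<lambda>k. integral\<^sup>L ?M (?f k)) sums (LINT z|?M. (\<Sum>k. ?f k z))"
  proof (rule sums_integral[OF int])
    show "AE z in ?M. summable (\<lambda>k. norm (?f k z))"
      using bound by (intro AE_I2 summable_comparison_test'[OF summable]) auto
    have "integral\<^sup>L ?M (\<lambda>z. norm (?f k z)) \<le> (LINT z|?M. norm (c k * of_real r ^ k))" for k
      using bound int by (intro integral_mono integrable_norm) auto
    thus "summable (\<lambda>k. integral\<^sup>L ?M (\<lambda>z. norm (?f k z)))"
      by (intro summable_comparison_test'[OF summable_mult[OF summable, of "measure ?M unit_disc"]])
        (auto simp: mult_ac)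
  qed
  also have "(LINT z|?M. (\<Sum>k. ?f k z))
      = (LINT z|?M. indicator (ball 0 r) z *\<^sub>R (h z * cnj z ^ n))"
  proof (rule Bochner_Integration.integral_cong)
    fix z assume "z \<in> space ?M"
    hence "(\<lambda>k. ?f k z) sums (indicator (ball 0 r) z *\<^sub>R (h z * cnj z ^ n))"
      using h by (intro sums_scaleR_right sums_mult2) auto
    thus "(\<Sum>k. ?f k z) = indicator (ball 0 r) z *\<^sub>R (h z * cnj z ^ n)"
      by (rule sums_unique[symmetric])
  qed simp
  also have "(\<lambda>k. integral\<^sup>L ?M (?f k))
      = (\<lambda>k. if k = n then c k * (LINT z|?M. indicator (ball 0 r) z *\<^sub>R (z ^ k * cnj z ^ n)) else 0)"
  proof
    fix k
    have "integral\<^sup>L ?M (?f k)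
        = (LINT z|?M. c k * (indicator (ball 0 r) z *\<^sub>R (z ^ k * cnj z ^ n)))"
      by (simp add: mult_ac)
    also have "\<dots> = c k * (LINT z|?M. indicator (ball 0 r) z *\<^sub>R (z ^ k * cnj z ^ n))"
      by (rule integral_mult_right_zero)
    finally show "integral\<^sup>L ?M (?f k)
        = (if k = n then c k * (LINT z|?M. indicator (ball 0 r) z *\<^sub>R (z ^ k * cnj z ^ n)) else 0)"
      using integral_bergman_monomials_orthogonal[OF \<xi>] by simp
  qed
  finally show ?thesis
    by (rule sums_unique2) (rule sums_single)
qed

text \<open>
  The radii \<open>1 - 1 / (2 + j)\<close> are just a convenient sequence in the open unit interval tending
  to \<open>1\<close>; the truncations are dominated by \<open>\<bar>h\<bar>\<close>.
\<close>

lemma integral_bergman_truncation_tendsto: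
  fixes h :: "complex \<Rightarrow> complex"
  assumes h: "integrable (bergman_measure \<xi>) h"
  shows "(\<lambda>j. LINT z|bergman_measure \<xi>. indicator (ball 0 (1 - 1 / (2 + real j))) z *\<^sub>R h z)
    \<longlonglongrightarrow> (LINT z|bergman_measure \<xi>. h z)"
proof (rule integral_dominated_convergence[where w = "\<lambda>z. norm (h z)"])
  show "h \<in> borel_measurable (bergman_measure \<xi>)" using h by auto
  show "(\<lambda>z. indicator (ball 0 (1 - 1 / (2 + real j))) z *\<^sub>R h z)
      \<in> borel_measurable (bergman_measure \<xi>)" for j
    using h
    by (intro borel_measurable_truncation borel_measurable_bergman_measure[of "\<lambda>z. z"]) auto
  show "AE z in bergman_measure \<xi>.
      (\<lambda>j. indicator (ball 0 (1 - 1 / (2 + real j))) z *\<^sub>R h z) \<longlonglongrightarrow> h z"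
  proof (rule AE_I2)
    fix z assume "z \<in> space (bergman_measure \<xi>)"
    hence z: "cmod z < 1" by (simp add: unit_disc_def)
    have "(\<lambda>j. 1 - 1 / (2 + real j)) \<longlonglongrightarrow> 1" by real_asymp
    from order_tendstoD(1)[OF this z]
    have "eventually (\<lambda>j. indicator (ball 0 (1 - 1 / (2 + real j))) z *\<^sub>R h z = h z) sequentially"
      by eventually_elim simp
    thus "(\<lambda>j. indicator (ball 0 (1 - 1 / (2 + real j))) z *\<^sub>R h z) \<longlonglongrightarrow> h z"
      by (rule tendsto_eventually)
  qed
  show "AE z in bergman_measure \<xi>.
      norm (indicator (ball 0 (1 - 1 / (2 + real j))) z *\<^sub>R h z) \<le> norm (h z)" for j
    by (intro AE_I2) (simp add: indicator_def)
qed (use h in simp)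

text \<open>
  Letting the truncation radius tend to \<open>1\<close> removes it. Integrability of \<open>h\<close> is the right
  hypothesis, rather than membership in the Bergman space: it passes at once to products of
  \<open>h\<close> with bounded functions, such as \<open>f p' + g p\<close>.
\<close>

lemma integral_bergman_coefficient:
  fixes h :: "complex \<Rightarrow> complex"
  assumes \<xi>: "\<xi> > -1" and int: "integrable (bergman_measure \<xi>) h"
    and h: "\<And>z. z \<in> unit_disc \<Longrightarrow> (\<lambda>k. c k * z ^ k) sums h z"
  shows "(LINT z|bergman_measure \<xi>. h z * cnj z ^ n) = c n * of_real (bergman_moment \<xi> n)"
proof -
  let ?M = "bergman_measure \<xi>"
  let ?r = "\<lambda>j. 1 - 1 / (2 + real j)"
  have int1: "integrable ?M (\<lambda>z. h z * cnj z ^ n)"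
    using int by (rule integrable_bergman_bounded_mult[where C = 1])
      (auto simp: unit_disc_def norm_power intro!: power_le_one)
  have "has_bochner_integral ?M (\<lambda>z. complex_of_real (cmod z ^ (2 * n))) (of_real (bergman_moment \<xi> n))"
    using has_bochner_integral_norm_power_bergman[OF \<xi>] by (rule has_bochner_integral_of_real)
  moreover have "complex_of_real (cmod z ^ (2 * n)) = z ^ n * cnj z ^ n" for z
    by (simp only: power_mult of_real_power complex_norm_square[unfolded of_real_power] power_mult_distrib)
  ultimately have moment: "has_bochner_integral ?M (\<lambda>z. z ^ n * cnj z ^ n) (of_real (bergman_moment \<xi> n))"
    by simp
  have "(\<lambda>j. LINT z|?M. indicator (ball 0 (?r j)) z *\<^sub>R (h z * cnj z ^ n))
      \<longlonglongrightarrow> (LINT z|?M. h z * cnj z ^ n)"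
    by (rule integral_bergman_truncation_tendsto[OF int1])
  also have "(\<lambda>j. LINT z|?M. indicator (ball 0 (?r j)) z *\<^sub>R (h z * cnj z ^ n))
      = (\<lambda>j. c n * (LINT z|?M. indicator (ball 0 (?r j)) z *\<^sub>R (z ^ n * cnj z ^ n)))"
    by (intro ext integral_bergman_truncated_coefficient \<xi> h) auto
  finally have "(\<lambda>j. c n * (LINT z|?M. indicator (ball 0 (?r j)) z *\<^sub>R (z ^ n * cnj z ^ n)))
      \<longlonglongrightarrow> (LINT z|?M. h z * cnj z ^ n)" .
  moreover have "(\<lambda>j. c n * (LINT z|?M. indicator (ball 0 (?r j)) z *\<^sub>R (z ^ n * cnj z ^ n)))
      \<longlonglongrightarrow> c n * of_real (bergman_moment \<xi> n)"
    using integral_bergman_truncation_tendsto[of \<xi> "\<lambda>z. z ^ n * cnj z ^ n"] moment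
    by (intro tendsto_mult_left) (auto simp: has_bochner_integral_iff)
  ultimately show ?thesis by (rule LIMSEQ_unique)
qed

lemma bergman_coefficients_unique:
  fixes h :: "complex \<Rightarrow> complex"
  assumes "\<xi> > -1" "integrable (bergman_measure \<xi>) h"
    and "\<And>z. z \<in> unit_disc \<Longrightarrow> (\<lambda>k. c k * z ^ k) sums h z"
    and "\<And>z. z \<in> unit_disc \<Longrightarrow> (\<lambda>k. d k * z ^ k) sums h z"
  shows "c = d"
proof
  fix n
  note coefficient = integral_bergman_coefficient[OF assms(1,2), where n = n]
  have "(LINT z|bergman_measure \<xi>. h z * cnj z ^ n) = c n * of_real (bergman_moment \<xi> n)"
    by (rule coefficient[where c = c]) (rule assms(3))
  moreover have "(LINT z|bergman_measure \<xi>. h z * cnj z ^ n) = d n * of_real (bergman_moment \<xi> n)"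
    by (rule coefficient[where c = d]) (rule assms(4))
  ultimately have "c n * of_real (bergman_moment \<xi> n) = d n * of_real (bergman_moment \<xi> n)"
    by (rule trans[OF sym])
  thus "c n = d n"
    using bergman_moment_pos[OF assms(1), of n]
    by (simp only: mult_cancel_right of_real_eq_0_iff) auto
qed

lemma integrable_bergman_space:
  assumes "\<xi> > -1" "h \<in> bergman_space \<xi>"
  shows "integrable (bergman_measure \<xi>) h"
proof (rule Bochner_Integration.integrable_bound)
  interpret finite_measure "bergman_measure \<xi>" by (rule finite_measure_bergman[OF assms(1)])
  show "integrable (bergman_measure \<xi>) (\<lambda>z. 1 + (cmod (h z))\<^sup>2)"
    using assms(2) by (simp add: bergman_space_def)
  have "h \<in> borel_measurable (restrict_space borel unit_disc)"
    using assms(2) by (intro borel_measurable_continuous_on_restrict holomorphic_on_imp_continuous_on)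
      (simp add: bergman_space_def)
  thus "h \<in> borel_measurable (bergman_measure \<xi>)"
    by (simp add: measurable_cong_sets[OF sets_bergman_measure refl])
  have "x \<le> 1 + x\<^sup>2" for x :: real
    using sum_power2_ge_zero[of "x - 1" x] by (simp add: power2_eq_square algebra_simps)
  thus "AE z in bergman_measure \<xi>. norm (h z) \<le> norm (1 + (cmod (h z))\<^sup>2)"
    by (intro AE_I2) (simp add: abs_of_nonneg)
qed

section \<open>The matrix of the operator on monomials\<close>

text \<open>
  The coefficient of \<open>z\<^sup>j\<close> in \<open>L z\<^sup>m = m z\<^bsup>m-1\<^esup> f + z\<^sup>m g\<close>. The first guard reads
  \<open>m \<le> Suc j\<close> instead of \<open>m - 1 \<le> j\<close> so that the truncated subtraction in the index is exact;
  for \<open>m = 0\<close> the factor \<open>m\<close> removes that summand.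
\<close>

definition operator_coeff :: "(nat \<Rightarrow> complex) \<Rightarrow> (nat \<Rightarrow> complex) \<Rightarrow> nat \<Rightarrow> nat \<Rightarrow> complex" where
  "operator_coeff a b m j =
     (if m \<le> Suc j then of_nat m * a (Suc j - m) else 0) + (if m \<le> j then b (j - m) else 0)"

lemma sums_power_mult_shift:
  fixes z :: complex
  assumes "(\<lambda>k. c k * z ^ k) sums s"
  shows "(\<lambda>j. (if m \<le> j then c (j - m) else 0) * z ^ j) sums (s * z ^ m)"
proof -
  have "(\<lambda>i. (if m \<le> i + m then c (i + m - m) else 0) * z ^ (i + m)) sums (s * z ^ m)"
    using sums_mult2[OF assms, of "z ^ m"] by (simp add: power_add mult.assoc)
  thus ?thesis by (subst (asm) sums_zero_iff_shift) auto
qed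

lemma first_order_operator_power:
  "first_order_operator f g (\<lambda>z. z ^ m) z = of_nat m * (f z * z ^ (m - 1)) + g z * z ^ m"
proof -
  have "deriv (\<lambda>z. z ^ m) z = of_nat m * z ^ (m - 1)"
    by (rule DERIV_imp_deriv) (auto intro!: derivative_eq_intros)
  thus ?thesis by (simp add: first_order_operator_def)
qed

lemma first_order_operator_power_sums:
  assumes "(\<lambda>k. a k * z ^ k) sums f z" "(\<lambda>k. b k * z ^ k) sums g z"
  shows "(\<lambda>j. operator_coeff a b m j * z ^ j) sums first_order_operator f g (\<lambda>z. z ^ m) z"
proof -
  have "(\<lambda>j. of_nat m * ((if m - 1 \<le> j then a (j - (m - 1)) else 0) * z ^ j)
      + (if m \<le> j then b (j - m) else 0) * z ^ j) sums first_order_operator f g (\<lambda>z. z ^ m) z"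
    unfolding first_order_operator_power
    by (intro sums_add sums_mult sums_power_mult_shift assms)
  moreover have "of_nat m * ((if m - 1 \<le> j then a (j - (m - 1)) else 0) * z ^ j)
      + (if m \<le> j then b (j - m) else 0) * z ^ j = operator_coeff a b m j * z ^ j" for j
    by (cases m) (simp_all add: operator_coeff_def distrib_right)
  ultimately show ?thesis by (simp only:)
qed

lemma integrable_first_order_operator_power:
  assumes "integrable (bergman_measure \<xi>) f" "integrable (bergman_measure \<xi>) g"
  shows "integrable (bergman_measure \<xi>) (first_order_operator f g (\<lambda>z. z ^ m))"
proof -
  have "integrable (bergman_measure \<xi>) (\<lambda>z. h z * z ^ k)"
    if "integrable (bergman_measure \<xi>) h" for h :: "complex \<Rightarrow> complex" and k
    using that by (rule integrable_bergman_bounded_mult[where C = 1])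
      (auto simp: unit_disc_def norm_power intro!: power_le_one)
  thus ?thesis
    unfolding first_order_operator_power[abs_def]
    using assms by (intro Bochner_Integration.integrable_add integrable_mult_right) auto
qed

lemma first_order_operator_poly:
  "first_order_operator f g (poly p) z
    = (\<Sum>i\<le>degree p. coeff p i * first_order_operator f g (\<lambda>z. z ^ i) z)"
proof -
  have "((\<lambda>z. \<Sum>i\<le>degree p. coeff p i * z ^ i) has_field_derivative
      (\<Sum>i\<le>degree p. coeff p i * (of_nat i * z ^ (i - 1)))) (at z)"
    by (intro DERIV_sum DERIV_cmult) (auto intro!: derivative_eq_intros)
  hence "deriv (poly p) z = (\<Sum>i\<le>degree p. coeff p i * (of_nat i * z ^ (i - 1)))"
    by (intro DERIV_imp_deriv) (simp add: poly_altdef[abs_def])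
  thus ?thesis
    by (simp add: first_order_operator_power) 
      (simp add: first_order_operator_def poly_altdef sum_distrib_left sum.distrib algebra_simps)
qed

lemma bergman_inner_commute: "bergman_inner \<xi> h k = cnj (bergman_inner \<xi> k h)"
proof -
  have "bergman_inner \<xi> h k = (LINT z|bergman_measure \<xi>. cnj (k z * cnj (h z)))"
    by (simp add: bergman_inner_def mult.commute)
  thus ?thesis by (simp only: Bochner_Integration.integral_cnj bergman_inner_def)
qed

lemma bergman_inner_first_order_operator_poly:
  assumes \<xi>: "\<xi> > -1" and f: "integrable (bergman_measure \<xi>) f" and g: "integrable (bergman_measure \<xi>) g"
    and a: "\<And>z. z \<in> unit_disc \<Longrightarrow> (\<lambda>k. a k * z ^ k) sums f z"
    and b: "\<And>z. z \<in> unit_disc \<Longrightarrow> (\<lambda>k. b k * z ^ k) sums g z"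
  shows "bergman_inner \<xi> (first_order_operator f g (poly p)) (poly q)
    = (\<Sum>i\<le>degree p. \<Sum>j\<le>degree q.
        coeff p i * cnj (coeff q j) * (operator_coeff a b i j * of_real (bergman_moment \<xi> j)))"
proof -
  let ?M = "bergman_measure \<xi>" and ?L = "\<lambda>i. first_order_operator f g (\<lambda>z. z ^ i)"
  have L: "integrable ?M (?L i)" for i
    by (rule integrable_first_order_operator_power[OF f g])
  have int: "integrable ?M (\<lambda>z. ?L i z * cnj z ^ j)" for i j
    by (rule integrable_bergman_bounded_mult[OF L, where C = 1])
      (auto simp: unit_disc_def norm_power intro!: power_le_one)
  have "bergman_inner \<xi> (first_order_operator f g (poly p)) (poly q)
      = (LINT z|?M. (\<Sum>i\<le>degree p. \<Sum>j\<le>degree q.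
          coeff p i * cnj (coeff q j) * (?L i z * cnj z ^ j)))"
    unfolding bergman_inner_def
    by (intro Bochner_Integration.integral_cong refl)
      (simp only: first_order_operator_poly poly_altdef cnj_sum complex_cnj_mult complex_cnj_power
        sum_product mult.assoc mult.left_commute[of "first_order_operator _ _ _ _"])
  also have "\<dots> = (\<Sum>i\<le>degree p. \<Sum>j\<le>degree q.
      coeff p i * cnj (coeff q j) * (LINT z|?M. ?L i z * cnj z ^ j))"
    by (simp add: Bochner_Integration.integral_sum integrable_mult_right int)
  also have "\<dots> = (\<Sum>i\<le>degree p. \<Sum>j\<le>degree q.
      coeff p i * cnj (coeff q j) * (operator_coeff a b i j * of_real (bergman_moment \<xi> j)))"
    by (intro sum.cong refl arg_cong2[of _ _ _ _ "(*)"] integral_bergman_coefficient[OF \<xi> L]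
      first_order_operator_power_sums a b)
  finally show ?thesis .
qed

text \<open>
  Both sides of the symmetry condition are sesquilinear in the two polynomials, so it suffices to
  compare them on pairs of monomials.
\<close>

lemma symmetric_first_order_operator_iff_matrix:
  assumes \<xi>: "\<xi> > -1" and f: "integrable (bergman_measure \<xi>) f" and g: "integrable (bergman_measure \<xi>) g"
    and a: "\<And>z. z \<in> unit_disc \<Longrightarrow> (\<lambda>k. a k * z ^ k) sums f z"
    and b: "\<And>z. z \<in> unit_disc \<Longrightarrow> (\<lambda>k. b k * z ^ k) sums g z"
  shows "symmetric_operator \<xi> polynomial_functions (first_order_operator f g) \<longleftrightarrow>
    (\<forall>m n. operator_coeff a b m n * of_real (bergman_moment \<xi> n)
      = cnj (operator_coeff a b n m) * of_real (bergman_moment \<xi> m))"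
    (is "_ \<longleftrightarrow> (\<forall>m n. ?E m n = ?E' m n)")
proof -
  let ?L = "first_order_operator f g"
  note inner = bergman_inner_first_order_operator_poly[OF assms]
  have left: "bergman_inner \<xi> (?L (poly p)) (poly q)
      = (\<Sum>i\<le>degree p. \<Sum>j\<le>degree q. coeff p i * cnj (coeff q j) * ?E i j)" for p q
    by (rule inner)
  have right: "bergman_inner \<xi> (poly p) (?L (poly q))
      = (\<Sum>i\<le>degree p. \<Sum>j\<le>degree q. coeff p i * cnj (coeff q j) * ?E' i j)" for p q
  proof -
    have "bergman_inner \<xi> (poly p) (?L (poly q)) = cnj (bergman_inner \<xi> (?L (poly q)) (poly p))"
      by (rule bergman_inner_commute)
    also have "\<dots> = (\<Sum>j\<le>degree q. \<Sum>i\<le>degree p. coeff p i * cnj (coeff q j) * ?E' i j)"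
      by (simp only: inner) (simp add: mult_ac)
    finally show ?thesis by (subst sum.swap)
  qed
  show ?thesis
  proof
    assume "\<forall>m n. ?E m n = ?E' m n"
    thus "symmetric_operator \<xi> polynomial_functions ?L"
      by (auto simp: symmetric_operator_def polynomial_functions_def left right)
  next
    assume sym: "symmetric_operator \<xi> polynomial_functions ?L"
    show "\<forall>m n. ?E m n = ?E' m n"
    proof (intro allI)
      fix m n
      have single: "(\<Sum>i\<le>degree (monom (1::complex) m). \<Sum>j\<le>degree (monom (1::complex) n).
          coeff (monom 1 m) i * cnj (coeff (monom 1 n) j) * F i j) = F m n" for F
      proof -
        have "(\<Sum>j\<le>n. coeff (monom 1 m) i * cnj (coeff (monom 1 n) j) * F i j)
            = (\<Sum>j\<le>n. if j = n then (if i = m then F i j else 0) else 0)" for i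
          by (rule sum.cong) auto
        thus ?thesis by (simp add: degree_monom_eq)
      qed
      have "bergman_inner \<xi> (?L (poly (monom 1 m))) (poly (monom 1 n))
          = bergman_inner \<xi> (poly (monom 1 m)) (?L (poly (monom 1 n)))"
        using sym by (auto simp: symmetric_operator_def polynomial_functions_def)
      thus "?E m n = ?E' m n" unfolding left right single .
    qed
  qed
qed

section \<open>Symmetric operators\<close>

text \<open>
  The condition splits according to the distance from the diagonal, and on each diagonal the entry
  of index \<open>n\<close> is affine in \<open>n\<close> after the moments have been cancelled. Hence each diagonal gives
  exactly two conditions, one for the constant term and one for the slope:
  on the main diagonal \<open>n a\<^sub>1 + b\<^sub>0\<close> is real; on the neighbouring one
  \<open>(n + \<xi> + 2) a\<^sub>0\<close> is the conjugate of \<open>n a\<^sub>2 + b\<^sub>1\<close>, by the recurrence for the moments; at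
  distance \<open>k \<ge> 2\<close> one of the two entries vanishes, since differentiation lowers the degree
  only by one, so \<open>n a\<^sub>k\<^sub>+\<^sub>1 + b\<^sub>k = 0\<close>.
\<close>

lemma operator_matrix_hermitian_iff:
  assumes \<xi>: "\<xi> > -1"
  shows "(\<forall>m n. operator_coeff a b m n * of_real (bergman_moment \<xi> n)
      = cnj (operator_coeff a b n m) * of_real (bergman_moment \<xi> m)) \<longleftrightarrow>
    a 1 \<in> \<real> \<and> b 0 \<in> \<real> \<and> a 2 = cnj (a 0) \<and> b 1 = of_real (\<xi> + 2) * cnj (a 0) \<and>
    (\<forall>k\<ge>3. a k = 0) \<and> (\<forall>k\<ge>2. b k = 0)"
    (is "(\<forall>m n. ?E m n = ?E' m n) \<longleftrightarrow> ?R")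
proof
  let ?w = "\<lambda>n. complex_of_real (bergman_moment \<xi> n)"
  have w: "?w n \<noteq> 0" for n
    using bergman_moment_pos[OF \<xi>, of n] by simp
  have w_Suc: "(of_nat n + of_real \<xi> + 2) * ?w (Suc n) = (of_nat n + 1) * ?w n" for n
    using arg_cong[OF bergman_moment_Suc[of n \<xi>], of complex_of_real] by simp
  have sub: "?E (Suc n) n = ?E' (Suc n) n \<longleftrightarrow>
      (of_nat n + of_real \<xi> + 2) * a 0 = cnj (of_nat n * a 2 + b 1)" for n
  proof -
    have "?E (Suc n) n = ((of_nat n + 1) * ?w n) * a 0"
      by (simp add: operator_coeff_def mult_ac add_ac)
    also have "\<dots> = (of_nat n + of_real \<xi> + 2) * a 0 * ?w (Suc n)"
      by (simp only: w_Suc[symmetric] mult_ac)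
    finally have "?E (Suc n) n = (of_nat n + of_real \<xi> + 2) * a 0 * ?w (Suc n)" .
    moreover have "?E' (Suc n) n = cnj (of_nat n * a 2 + b 1) * ?w (Suc n)"
      by (simp add: operator_coeff_def Suc_diff_le numeral_2_eq_2)
    ultimately show ?thesis using w[of "Suc n"] by (simp only: mult_cancel_right) auto
  qed
  have diag: "?E n n = ?E' n n \<longleftrightarrow> of_nat n * a 1 + b 0 \<in> \<real>" for n
    using w[of n] by (auto simp: operator_coeff_def Reals_cnj_iff)
  have far: "?E (n + d + 2) n = ?E' (n + d + 2) n \<longleftrightarrow> of_nat n * a (d + 3) + b (d + 2) = 0" for n d
  proof -
    have "?E (n + d + 2) n = 0"
      by (simp add: operator_coeff_def)
    moreover have "?E' (n + d + 2) n = cnj (of_nat n * a (d + 3) + b (d + 2)) * ?w (n + d + 2)"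
      by (simp add: operator_coeff_def Suc_diff_le eval_nat_numeral)
    ultimately have "?E (n + d + 2) n = ?E' (n + d + 2) n \<longleftrightarrow>
        cnj (of_nat n * a (d + 3) + b (d + 2)) = 0"
      using w[of "n + d + 2"] by (metis mult_eq_0_iff)
    thus ?thesis by (simp only: complex_cnj_zero_iff)
  qed
  {
    assume H: "\<forall>m n. ?E m n = ?E' m n"
    have "of_nat 0 * a 1 + b 0 \<in> \<real>" "of_nat 1 * a 1 + b 0 \<in> \<real>"
      using H diag by blast+
    hence r: "b 0 \<in> \<real>" "a 1 \<in> \<real>"
      using Reals_diff[of "a 1 + b 0" "b 0"] by auto
    have "(of_nat n + of_real \<xi> + 2) * a 0 = cnj (of_nat n * a 2 + b 1)" for n
      using H sub by blast
    \<comment> \<open>Two values of \<open>n\<close> determine the constant term and the slope.\<close>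
    from this[of 0] this[of 1]
    have s1: "cnj (b 1) = (of_real \<xi> + 2) * a 0"
      and "(of_real \<xi> + 3) * a 0 = cnj (a 2) + cnj (b 1)"
      by (simp_all add: add_ac)
    from this(2) have s2: "cnj (a 2) = a 0"
      unfolding s1 by (simp add: algebra_simps)
    have "of_nat n * a (d + 3) + b (d + 2) = 0" for n d
      using H far by blast
    from this[of 0] this[of 1] have "b (d + 2) = 0" "a (d + 3) = 0" for d
      by auto
    moreover have "k = (k - 3) + 3" if "k \<ge> 3" for k :: nat using that by simp
    moreover have "k = (k - 2) + 2" if "k \<ge> 2" for k :: nat using that by simp
    ultimately have "\<forall>k\<ge>3. a k = 0" "\<forall>k\<ge>2. b k = 0" by metis+
    moreover have "b 1 = of_real (\<xi> + 2) * cnj (a 0)" "a 2 = cnj (a 0)"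
      using arg_cong[OF s1, of cnj] arg_cong[OF s2, of cnj] by simp_all
    ultimately show ?R using r by blast
  }
  {
    assume R: ?R
    \<comment> \<open>Conjugation exchanges \<open>m\<close> and \<open>n\<close> in the condition, so the case \<open>n \<le> m\<close> suffices.\<close>
    have lower: "?E (n + d) n = ?E' (n + d) n" for n d
    proof -
      consider "d = 0" | "d = 1" | e where "d = e + 2"
        by (metis One_nat_def add_2_eq_Suc' not0_implies_Suc)
      thus ?thesis
      proof cases
        case 1
        thus ?thesis using R diag[of n] by simp
      next
        case 2
        thus ?thesis using R sub[of n] by (simp add: algebra_simps)
      next
        case 3
        thus ?thesis using R far[of n e] by (simp add: add.assoc)
      qed
    qed
    show "\<forall>m n. ?E m n = ?E' m n"
    proof (intro allI)
      fix m n
      show "?E m n = ?E' m n"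
      proof (cases "n \<le> m")
        case True
        thus ?thesis using lower[of n "m - n"] by simp
      next
        case False
        hence "?E n m = ?E' n m" using lower[of m "n - m"] by simp
        from arg_cong[OF this, of cnj] show ?thesis by simp
      qed
    qed
  }
qed

lemma quadratic_sums:
  fixes z :: complex
  assumes "\<And>k. k \<ge> 3 \<Longrightarrow> c k = 0"
  shows "(\<lambda>k. c k * z ^ k) sums (c 0 + c 1 * z + c 2 * z\<^sup>2)"
proof -
  have "(\<lambda>k. c k * z ^ k) sums (\<Sum>k<3. c k * z ^ k)"
    using assms by (intro sums_finite) auto
  thus ?thesis by (simp add: eval_nat_numeral)
qed

theorem theorem8:
  fixes \<xi> :: real and f g :: "complex \<Rightarrow> complex" and a b :: "nat \<Rightarrow> complex"
  assumes "\<xi> > -1"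
    and "f \<in> bergman_space \<xi>" and "g \<in> bergman_space \<xi>"
    and "\<And>z. z \<in> unit_disc \<Longrightarrow> (\<lambda>k. a k * z ^ k) sums f z"
    and "\<And>z. z \<in> unit_disc \<Longrightarrow> (\<lambda>k. b k * z ^ k) sums g z"
  shows "symmetric_operator \<xi> polynomial_functions (first_order_operator f g) \<longleftrightarrow>
    (\<forall>z\<in>unit_disc. f z = a 0 + a 1 * z + cnj (a 0) * z\<^sup>2) \<and>
    (\<forall>z\<in>unit_disc. g z = b 0 + complex_of_real (\<xi> + 2) * cnj (a 0) * z) \<and>
    a 1 \<in> \<real> \<and> b 0 \<in> \<real>"
proof -
  note int = integrable_bergman_space[OF assms(1,2)] integrable_bergman_space[OF assms(1,3)]
  let ?c = "\<lambda>k. if k = 0 then a 0 else if k = 1 then a 1 else if k = 2 then cnj (a 0) else 0"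
  let ?d = "\<lambda>k. if k = 0 then b 0 else if k = 1 then complex_of_real (\<xi> + 2) * cnj (a 0) else 0"
  have c: "(\<lambda>k. ?c k * z ^ k) sums (a 0 + a 1 * z + cnj (a 0) * z\<^sup>2)" for z
    using quadratic_sums[of ?c z] by simp
  have d: "(\<lambda>k. ?d k * z ^ k) sums (b 0 + complex_of_real (\<xi> + 2) * cnj (a 0) * z)" for z
    using quadratic_sums[of ?d z] by simp
  have f_iff: "(\<forall>z\<in>unit_disc. f z = a 0 + a 1 * z + cnj (a 0) * z\<^sup>2) \<longleftrightarrow> a = ?c"
  proof
    assume "\<forall>z\<in>unit_disc. f z = a 0 + a 1 * z + cnj (a 0) * z\<^sup>2"
    thus "a = ?c"
      using c by (intro bergman_coefficients_unique[OF assms(1) int(1) assms(4)]) auto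
  next
    assume "a = ?c"
    thus "\<forall>z\<in>unit_disc. f z = a 0 + a 1 * z + cnj (a 0) * z\<^sup>2"
      using c assms(4) by (metis sums_unique2)
  qed
  have g_iff: "(\<forall>z\<in>unit_disc. g z = b 0 + complex_of_real (\<xi> + 2) * cnj (a 0) * z) \<longleftrightarrow> b = ?d"
  proof
    assume "\<forall>z\<in>unit_disc. g z = b 0 + complex_of_real (\<xi> + 2) * cnj (a 0) * z"
    thus "b = ?d"
      using d by (intro bergman_coefficients_unique[OF assms(1) int(2) assms(5)]) auto
  next
    assume "b = ?d"
    thus "\<forall>z\<in>unit_disc. g z = b 0 + complex_of_real (\<xi> + 2) * cnj (a 0) * z"
      using d assms(5) by (metis sums_unique2)
  qed
  have a_iff: "a = ?c \<longleftrightarrow> a 2 = cnj (a 0) \<and> (\<forall>k\<ge>3. a k = 0)"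
  proof
    assume eq: "a = ?c"
    have "a 2 = cnj (a 0)"
      using fun_cong[OF eq, of 2] by simp
    moreover have "a k = 0" if "k \<ge> 3" for k
      using fun_cong[OF eq, of k] that by simp
    ultimately show "a 2 = cnj (a 0) \<and> (\<forall>k\<ge>3. a k = 0)" by blast
  next
    assume *: "a 2 = cnj (a 0) \<and> (\<forall>k\<ge>3. a k = 0)"
    show "a = ?c"
    proof
      fix k :: nat
      consider "k = 0" | "k = 1" | "k = 2" | "k \<ge> 3" by linarith
      thus "a k = ?c k" using * by cases auto
    qed
  qed
  have b_iff: "b = ?d \<longleftrightarrow> b 1 = of_real (\<xi> + 2) * cnj (a 0) \<and> (\<forall>k\<ge>2. b k = 0)"
  proof
    assume eq: "b = ?d"
    have "b 1 = of_real (\<xi> + 2) * cnj (a 0)"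
      using fun_cong[OF eq, of 1] by simp
    moreover have "b k = 0" if "k \<ge> 2" for k
      using fun_cong[OF eq, of k] that by simp
    ultimately show "b 1 = of_real (\<xi> + 2) * cnj (a 0) \<and> (\<forall>k\<ge>2. b k = 0)" by blast
  next
    assume *: "b 1 = of_real (\<xi> + 2) * cnj (a 0) \<and> (\<forall>k\<ge>2. b k = 0)"
    show "b = ?d"
    proof
      fix k :: nat
      consider "k = 0" | "k = 1" | "k \<ge> 2" by linarith
      thus "b k = ?d k" using * by cases auto
    qed
  qed
  have "symmetric_operator \<xi> polynomial_functions (first_order_operator f g) \<longleftrightarrow>
      (\<forall>m n. operator_coeff a b m n * of_real (bergman_moment \<xi> n)
        = cnj (operator_coeff a b n m) * of_real (bergman_moment \<xi> m))"
    by (rule symmetric_first_order_operator_iff_matrix[OF assms(1) int]) (fact assms(4,5))+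
  also have "\<dots> \<longleftrightarrow> a 1 \<in> \<real> \<and> b 0 \<in> \<real> \<and> a 2 = cnj (a 0) \<and>
      b 1 = of_real (\<xi> + 2) * cnj (a 0) \<and> (\<forall>k\<ge>3. a k = 0) \<and> (\<forall>k\<ge>2. b k = 0)"
    by (rule operator_matrix_hermitian_iff[OF assms(1)])
  finally show ?thesis
    unfolding f_iff g_iff a_iff b_iff by blast
qed

end
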